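(* Consider SPDHG (as in the context) run with step-sizes $\beta^{k+1} = \frac{1}{\sqrt{k+1}+L}$ and uniform weights $\alpha^{k+1}=\frac{1}{t+1}$, $k=0,\dots,t$. Let $(y^*,x^* )$ be any saddle point of $\min_{x\in\mathcal{X}}\max_{y\in\mathcal{Y}}P(y,x)$. Then for every $\Omega>0$ and $t\ge0$, $$\mathrm{Prob}\left(P(y^*,\bar{x}^t) - P(\bar{y}^t,x^* ) > \frac{D_y^2}{2s(t+1)} + \frac{L D_x^2}{2(t+1)} + \frac{D_x^2+2\lambda_{\max}(F^\top F)D_y^2}{\sqrt{t+1}} + \frac{2\sqrt{\Omega} D_x \sigma}{\sqrt{t+1}} + \frac{(1+\Omega) \sigma^2}{\sqrt{t+1}}\right)\leq 2\exp(-\Omega).$$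
   Context: Setting: $\mathcal{X}\subset\mathbb{R}^d$ is a nonempty convex compact set with diameter $D_x$ (so $\|x-x'\|\le D_x$ for all $x,x'\in\mathcal{X}$), $\mathcal{Y}\subset\mathbb{R}^l$ is a nonempty convex compact set with diameter $D_y$, $F\in\mathbb{R}^{l\times d}$, and $\lambda_{\max}(F^\top F)$ denotes the largest eigenvalue of $F^\top F$. The loss is $l(x)=\mathbb{E}_\xi[l(x,\xi)]$, a convex, continuously differentiable function on $\mathcal{X}$ with $L$-Lipschitz gradient: $\|\nabla l(x_1)-\nabla l(x_2)\|\le L\|x_1-x_2\|$ for all $x_1,x_2\in\mathcal{X}$. The stochastic gradient $\nabla l(x,\xi)$ satisfies, for every $x\in\mathcal{X}$: $\mathbb{E}[\nabla l(x,\xi)]=\nabla l(x)$, $\mathbb{E}\|\nabla l(x,\xi)-\nabla l(x)\|^2\le\sigma^2$, and $\mathbb{E}\exp\left(\|\nabla l(x,\xi)-\nabla l(x)\|^2/\sigma^2\right)\le \exp(1)$, for a constant $\sigma>0$. The saddle function is $P(y,x)=l(x)+\langle y,Fx\rangle$ for $x\in\mathcal{X},y\in\mathcal{Y}$; a saddle point $(y^*,x^* )$ satisfies $P(y,x^* )\le P(y^*,x^* )\le P(y^*,x)$ for all $(y,x)\in\mathcal{Y}\times\mathcal{X}$ (assumed to exist). SPDHG: fix $s>0$, $x^0\in\mathcal{X}$, $y^0\in\mathcal{Y}$, and a sequence of step-sizes $\beta^{k+1}>0$. For $k=0,1,2,\dots$, draw a sample $\xi^{k+1}$ independently of the past (i.i.d.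 samples), and set $$y^{k+1}=\arg\max_{y\in\mathcal{Y}}\Big\{P(y,x^k)-\tfrac{1}{2s}\|y-y^k\|^2\Big\},\qquad x^{k+1}=\Pi_{\mathcal{X}}\Big[x^k-\beta^{k+1}\big(\nabla l(x^k,\xi^{k+1})+F^\top y^{k+1}\big)\Big],$$ where $\Pi_{\mathcal{X}}$ is Euclidean projection onto $\mathcal{X}$. Given weights $\alpha^{k+1}\ge0$ with $\sum_{k=0}^t\alpha^{k+1}=1$, the output after $t$ steps is $\bar x^t=\sum_{k=0}^t\alpha^{k+1}x^{k+1}$, $\bar y^t=\sum_{k=0}^t\alpha^{k+1}y^{k+1}$. *)

theory Defs
  imports "HOL-Probability.Probability"
begin

definition lambda_max :: "real^'n^'n \<Rightarrow> real" where
  "lambda_max A = Max {\<mu>. \<exists>v. v \<noteq> 0 \<and> A *v v = \<mu> *\<^sub>R v}"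

definition saddle_P :: "(real^'d \<Rightarrow> real) \<Rightarrow> real^'d^'l \<Rightarrow> real^'l \<Rightarrow> real^'d \<Rightarrow> real" where
  "saddle_P l F y x = l x + y \<bullet> (F *v x)"

text \<open>SPDHG iterates (y^k, x^k) driven by the sample sequence xs; the sample
  xi^{k+1} is xs k, and beta (k+1) is the step size beta^{k+1}.\<close>
fun spdhg ::
  "(real^'d \<Rightarrow> real) \<Rightarrow> (real^'d \<Rightarrow> 's \<Rightarrow> real^'d) \<Rightarrow> real^'d^'l \<Rightarrow>
   (real^'d) set \<Rightarrow> (real^'l) set \<Rightarrow> real \<Rightarrow> (nat \<Rightarrow> real) \<Rightarrow> real^'d \<Rightarrow> real^'l \<Rightarrow>
   (nat \<Rightarrow> 's) \<Rightarrow> nat \<Rightarrow> (real^'l) \<times> (real^'d)" where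
  "spdhg l G F X Y s beta x0 y0 xs 0 = (y0, x0)"
| "spdhg l G F X Y s beta x0 y0 xs (Suc k) =
     (let (yk, xk) = spdhg l G F X Y s beta x0 y0 xs k;
          y' = arg_max_on (\<lambda>y. saddle_P l F y xk - (1 / (2 * s)) * (norm (y - yk))\<^sup>2) Y;
          x' = closest_point X (xk - beta (Suc k) *\<^sub>R (G xk (xs k) + transpose F *v y'))
      in (y', x'))"

end

theory Submission
  imports Defs
begin

text \<open>
  Write \<delta> for the error of the stochastic gradient at x^k and r = sqrt(k+1), so that the step
  size is 1/(r+L). The optimality conditions of the two proximal steps, convexity and the descent
  lemma bound the saddle gap at step k by telescoping terms plus
  <c, x^{k+1} - x^k> - r/2 |x^{k+1} - x^k|^2 - <\<delta>, x^{k+1} - x*>, where c = F^T(y* - y^{k+1}).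
  Bounding this crudely leaves a cross term |c||\<delta>|, which costs a factor 2 in front of \<sigma>^2.
  Instead, x^{k+1} is compared with the projection p of x^k + c/r, which maximises the first two
  terms over X and does not depend on the fresh sample: strong concavity gives the bound
  (|c|^2 + |\<delta>|^2)/(2r) + <\<delta>, x* - p>. The last summand is a martingale difference with
  sub-Gaussian tails, by exp x \<le> x + exp(x^2), and the two noise sums are controlled by their
  exponential moments and a union bound.
\<close>

section \<open>The deterministic step inequality\<close>

text \<open>The obtuse-angle property of the projection, with the inner product of
  \<open>u - p\<close> and \<open>x - p\<close> expanded by polarisation. This is the optimality
  condition of a proximal step from \<open>u\<close> along \<open>v\<close>; it serves y^{k+1},
  x^{k+1} and the sample-free comparison point.\<close>

lemma closest_point_step_inner_le:
  fixes S :: "'a::euclidean_space set" and u v :: 'a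
  assumes "convex S" "closed S" "x \<in> S" "\<gamma> > 0"
  defines "p \<equiv> closest_point S (u + \<gamma> *\<^sub>R v)"
  shows "v \<bullet> (x - p) \<le> 1 / (2 * \<gamma>) * ((norm (x - u))\<^sup>2 - (norm (x - p))\<^sup>2 - (norm (p - u))\<^sup>2)"
proof -
  have "(u + \<gamma> *\<^sub>R v - p) \<bullet> (x - p) \<le> 0"
    unfolding p_def using assms(1-3) by (rule closest_point_dot)
  then have "2 * \<gamma> * (v \<bullet> (x - p)) \<le> (norm (x - u))\<^sup>2 - (norm (x - p))\<^sup>2 - (norm (p - u))\<^sup>2"
    by (simp add: power2_norm_eq_inner inner_diff_left inner_diff_right inner_add_left
        inner_add_right inner_commute algebra_simps)
  with \<open>\<gamma> > 0\<close> show ?thesis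
    by (simp add: field_simps)
qed

text \<open>Young's inequality, by completing the square.\<close>

lemma inner_minus_square_le:
  fixes c v :: "'a::real_inner"
  assumes "r > 0"
  shows "c \<bullet> v - r / 2 * (norm v)\<^sup>2 \<le> (norm c)\<^sup>2 / (2 * r)"
proof -
  have "0 \<le> (norm (c - r *\<^sub>R v))\<^sup>2"
    by simp
  also have "\<dots> = (norm c)\<^sup>2 - 2 * r * (c \<bullet> v) + r\<^sup>2 * (norm v)\<^sup>2"
    by (simp add: power2_norm_eq_inner inner_diff_left inner_diff_right inner_commute
        power2_eq_square[of r] algebra_simps)
  finally show ?thesis
    using assms by (simp add: field_simps power2_eq_square)
qed

text \<open>Chain rule on a segment. The gradient is known only within \<open>X\<close>, so the
  parameter is confined to [0,1], whose image stays in \<open>X\<close> by convexity; this covers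
  boundary points and sets without interior.\<close>

lemma has_derivative_along_segment:
  fixes l :: "'a::real_inner \<Rightarrow> real"
  assumes "convex X" "x \<in> X" "z \<in> X" "\<tau> \<in> {0..1}"
    and "\<forall>x\<in>X. (l has_derivative (\<lambda>h. gl x \<bullet> h)) (at x within X)"
  shows "((\<lambda>\<tau>. l (x + \<tau> *\<^sub>R (z - x))) has_derivative
           (\<lambda>h. h * (gl (x + \<tau> *\<^sub>R (z - x)) \<bullet> (z - x)))) (at \<tau> within {0..1})"
proof -
  have seg: "x + t *\<^sub>R (z - x) \<in> X" if "t \<in> {0..1}" for t
  proof -
    have "(1 - t) *\<^sub>R x + t *\<^sub>R z \<in> X"
      using that assms by (intro convexD) auto
    then show ?thesis by (simp add: algebra_simps)
  qed
  have "((\<lambda>\<tau>. x + \<tau> *\<^sub>R (z - x)) has_derivative (\<lambda>h. h *\<^sub>R (z - x))) (at \<tau> within {0..1})"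
    by (auto intro!: derivative_eq_intros)
  moreover have "(l has_derivative (\<lambda>h. gl (x + \<tau> *\<^sub>R (z - x)) \<bullet> h))
      (at (x + \<tau> *\<^sub>R (z - x)) within (\<lambda>\<tau>. x + \<tau> *\<^sub>R (z - x)) ` {0..1})"
    using assms(5) seg assms(4) by (blast intro: has_derivative_subset)
  ultimately show ?thesis
    by (auto dest: has_derivative_in_compose)
qed

text \<open>Along the segment, \<open>\<psi>\<close> is \<open>l\<close> minus the linear and
  quadratic terms of its upper model, and the claim is \<open>\<psi> 1 \<le> \<psi> 0\<close>. The
  mean value theorem reduces this to the sign of \<open>\<psi>'\<close>, which the Lipschitz bound
  controls pointwise.\<close>

lemma descent_lemma:
  fixes l :: "'a::real_inner \<Rightarrow> real"
  assumes "convex X" "x \<in> X" "z \<in> X"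
    and grad: "\<forall>x\<in>X. (l has_derivative (\<lambda>h. gl x \<bullet> h)) (at x within X)"
    and lip: "\<forall>x1\<in>X. \<forall>x2\<in>X. norm (gl x1 - gl x2) \<le> L * norm (x1 - x2)"
  shows "l z \<le> l x + gl x \<bullet> (z - x) + L / 2 * (norm (z - x))\<^sup>2"
proof -
  let ?d = "z - x"
  define \<psi> where "\<psi> = (\<lambda>\<tau>. l (x + \<tau> *\<^sub>R ?d) - \<tau> * (gl x \<bullet> ?d) - L / 2 * \<tau>\<^sup>2 * (norm ?d)\<^sup>2)"
  define \<psi>' where "\<psi>' = (\<lambda>\<tau> h. h * (gl (x + \<tau> *\<^sub>R ?d) \<bullet> ?d) - h * (gl x \<bullet> ?d)
    - L * \<tau> * h * (norm ?d)\<^sup>2)"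
  have "(\<psi> has_derivative \<psi>' \<tau>) (at \<tau> within {0..1})" if "0 \<le> \<tau>" "\<tau> \<le> 1" for \<tau>
  proof -
    have "((\<lambda>\<tau>. \<tau> * (gl x \<bullet> ?d) + L / 2 * \<tau>\<^sup>2 * (norm ?d)\<^sup>2) has_derivative
        (\<lambda>h. h * (gl x \<bullet> ?d) + L * \<tau> * h * (norm ?d)\<^sup>2)) (at \<tau> within {0..1})"
      by (auto intro!: derivative_eq_intros simp: fun_eq_iff)
    from has_derivative_diff[OF has_derivative_along_segment[OF assms(1-3) _ grad] this] that
    show ?thesis
      unfolding \<psi>_def \<psi>'_def by (simp add: diff_diff_eq)
  qed
  from mvt_simple[of 0 1 \<psi> \<psi>', OF _ this]
  obtain \<tau> where \<tau>: "0 < \<tau>" "\<tau> < 1" "\<psi> 1 - \<psi> 0 = \<psi>' \<tau> 1"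
    by auto
  have "(1 - \<tau>) *\<^sub>R x + \<tau> *\<^sub>R z \<in> X"
    using \<tau> assms by (intro convexD) auto
  then have "x + \<tau> *\<^sub>R ?d \<in> X"
    by (simp add: algebra_simps)
  then have "norm (gl (x + \<tau> *\<^sub>R ?d) - gl x) \<le> L * norm (x + \<tau> *\<^sub>R ?d - x)"
    using lip \<open>x \<in> X\<close> by blast
  then have "norm (gl (x + \<tau> *\<^sub>R ?d) - gl x) * norm ?d \<le> L * \<tau> * norm ?d * norm ?d"
    using \<tau> by (intro mult_right_mono) auto
  with norm_cauchy_schwarz[of "gl (x + \<tau> *\<^sub>R ?d) - gl x" ?d]
  have "(gl (x + \<tau> *\<^sub>R ?d) - gl x) \<bullet> ?d \<le> L * \<tau> * norm ?d * norm ?d"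
    by linarith
  then have "\<psi>' \<tau> 1 \<le> 0"
    by (simp add: \<psi>'_def inner_diff_left power2_eq_square algebra_simps)
  with \<tau> show ?thesis
    by (simp add: \<psi>_def)
qed

text \<open>By convexity every difference quotient from \<open>x\<close> towards \<open>z\<close> is
  at most \<open>l z - l x\<close>; the one-sided limit at parameter 0 is the directional
  derivative, so \<open>x\<close> may lie on the boundary.\<close>

lemma convex_above_tangent_within:
  fixes l :: "'a::real_inner \<Rightarrow> real"
  assumes "convex X" "x \<in> X" "z \<in> X" and cvx: "convex_on X l"
    and grad: "\<forall>x\<in>X. (l has_derivative (\<lambda>h. gl x \<bullet> h)) (at x within X)"
  shows "l x + gl x \<bullet> (z - x) \<le> l z"
proof -
  let ?\<phi> = "\<lambda>\<tau>. l (x + \<tau> *\<^sub>R (z - x))"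
  have "(?\<phi> has_derivative (\<lambda>h. h * (gl x \<bullet> (z - x)))) (at 0 within {0..1})"
    using has_derivative_along_segment[OF assms(1-3) _ grad, of 0] by simp
  then have "(?\<phi> has_field_derivative (gl x \<bullet> (z - x))) (at 0 within {0..1})"
    unfolding has_field_derivative_def by (simp add: mult_commute_abs)
  then have "((\<lambda>\<tau>. (?\<phi> \<tau> - ?\<phi> 0) / (\<tau> - 0)) \<longlongrightarrow> gl x \<bullet> (z - x)) (at 0 within {0..1})"
    unfolding has_field_derivative_iff .
  moreover have "\<forall>\<^sub>F \<tau> in at 0 within {0..1::real}. (?\<phi> \<tau> - ?\<phi> 0) / (\<tau> - 0) \<le> l z - l x"
    unfolding eventually_at_filter
  proof (rule always_eventually, intro allI impI)
    fix \<tau> :: real assume \<tau>: "\<tau> \<noteq> 0" "\<tau> \<in> {0..1}"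
    have "l ((1 - \<tau>) *\<^sub>R x + \<tau> *\<^sub>R z) \<le> (1 - \<tau>) * l x + \<tau> * l z"
      using \<tau> assms by (intro convex_onD[OF cvx]) auto
    moreover have "(1 - \<tau>) *\<^sub>R x + \<tau> *\<^sub>R z = x + \<tau> *\<^sub>R (z - x)"
      by (simp add: algebra_simps)
    ultimately show "(?\<phi> \<tau> - ?\<phi> 0) / (\<tau> - 0) \<le> l z - l x"
      using \<tau> by (simp add: field_simps)
  qed
  moreover have "at 0 within {0..1::real} \<noteq> bot"
    by (simp add: at_within_Icc_at_right)
  ultimately have "gl x \<bullet> (z - x) \<le> l z - l x"
    using tendsto_upperbound by blast
  then show ?thesis by simp
qed

text \<open>Here \<open>ys\<close> and \<open>xs\<close> are arbitrary comparison points and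
  \<open>\<delta>\<close> is an arbitrary gradient error, so the estimate is purely deterministic.
  The point \<open>xh\<close> does not involve \<open>\<delta>\<close>, which is what later makes
  the last term centred.\<close>

lemma primal_dual_step:
  fixes X :: "(real^'d) set" and Y :: "(real^'l) set" and F :: "real^'d^'l"
    and \<delta> :: "real^'d" and yk :: "real^'l"
  assumes X: "convex X" "closed X" and Y: "convex Y" "closed Y"
    and l_convex: "convex_on X l"
    and l_grad: "\<forall>x\<in>X. (l has_derivative (\<lambda>h. gl x \<bullet> h)) (at x within X)"
    and L: "L \<ge> 0" "\<forall>x1\<in>X. \<forall>x2\<in>X. norm (gl x1 - gl x2) \<le> L * norm (x1 - x2)"
    and pos: "s > 0" "r > 0"
    and mem: "xk \<in> X" "xs \<in> X" "ys \<in> Y"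
  defines "y' \<equiv> closest_point Y (yk + s *\<^sub>R (F *v xk))"
  defines "x' \<equiv> closest_point X (xk - (1 / (r + L)) *\<^sub>R (gl xk + \<delta> + transpose F *v y'))"
  defines "xh \<equiv> closest_point X (xk + (1 / r) *\<^sub>R (transpose F *v (ys - y')))"
  shows "saddle_P l F ys x' - saddle_P l F y' xs \<le>
      (r + L) / 2 * ((norm (xs - xk))\<^sup>2 - (norm (xs - x'))\<^sup>2)
      + 1 / (2 * s) * ((norm (ys - yk))\<^sup>2 - (norm (ys - y'))\<^sup>2)
      + ((norm (transpose F *v (ys - y')))\<^sup>2 + (norm \<delta>)\<^sup>2) / (2 * r)
      + \<delta> \<bullet> (xs - xh)"
proof -
  define c where "c = transpose F *v (ys - y')"
  have F: "v \<bullet> (F *v w) = (transpose F *v v) \<bullet> w" for v w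
    by (metis dot_lmul_matrix inner_commute transpose_matrix_vector)
  have "X \<noteq> {}" "Y \<noteq> {}"
    using mem by auto
  then have mem': "x' \<in> X" "xh \<in> X"
    unfolding x'_def xh_def using X closest_point_in_set by blast+
  have dual: "(F *v xk) \<bullet> (ys - y') \<le>
      1 / (2 * s) * ((norm (ys - yk))\<^sup>2 - (norm (ys - y'))\<^sup>2 - (norm (y' - yk))\<^sup>2)"
    unfolding y'_def using Y mem pos by (intro closest_point_step_inner_le)
  have primal: "(- (gl xk + \<delta> + transpose F *v y')) \<bullet> (xs - x') \<le>
      1 / (2 * (1 / (r + L))) * ((norm (xs - xk))\<^sup>2 - (norm (xs - x'))\<^sup>2 - (norm (x' - xk))\<^sup>2)"
    using closest_point_step_inner_le[OF X \<open>xs \<in> X\<close>, of "1 / (r + L)" "- (gl xk + \<delta> + transpose F *v y')" xk]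
      pos L unfolding x'_def scaleR_minus_right add_uminus_conv_diff by auto
  \<comment> \<open>\<open>xh\<close> maximises the strongly concave function
    \<open>c \<bullet> (x - xk) - r/2 |x - xk|^2\<close> over \<open>X\<close>; the surplus
    \<open>r/2 |x' - xh|^2\<close> in this inequality will absorb the noise.\<close>
  have aux: "c \<bullet> (x' - xh) \<le>
      1 / (2 * (1 / r)) * ((norm (x' - xk))\<^sup>2 - (norm (x' - xh))\<^sup>2 - (norm (xh - xk))\<^sup>2)"
    unfolding xh_def c_def using X mem' pos by (intro closest_point_step_inner_le) auto
  \<comment> \<open>The first bound estimates the maximum attained at \<open>xh\<close>; the second
    pays for replacing \<open>x'\<close> by \<open>xh\<close> in the noise term.\<close>
  have young: "c \<bullet> (xh - xk) - r / 2 * (norm (xh - xk))\<^sup>2 \<le> (norm c)\<^sup>2 / (2 * r)"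
    "(- \<delta>) \<bullet> (x' - xh) - r / 2 * (norm (x' - xh))\<^sup>2 \<le> (norm (- \<delta>))\<^sup>2 / (2 * r)"
    using inner_minus_square_le[OF pos(2)] by blast+
  have "l x' \<le> l xk + gl xk \<bullet> (x' - xk) + L / 2 * (norm (x' - xk))\<^sup>2"
    using X mem mem' L l_grad by (intro descent_lemma)
  moreover have "l xk + gl xk \<bullet> (xs - xk) \<le> l xs"
    using X mem l_convex l_grad by (intro convex_above_tangent_within)
  \<comment> \<open>The bilinear part is split around \<open>xk\<close>, since the dual step was
    taken there and not at \<open>x'\<close>; the mismatch is the residual
    \<open>c \<bullet> (x' - xk)\<close>.\<close>
  ultimately have "saddle_P l F ys x' - saddle_P l F y' xs \<le>
      gl xk \<bullet> (x' - xs) + L / 2 * (norm (x' - xk))\<^sup>2 + (transpose F *v y') \<bullet> (x' - xs)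
      + (F *v xk) \<bullet> (ys - y') + c \<bullet> (x' - xk)"
    unfolding saddle_P_def F c_def inner_commute[of "F *v xk"]
    by (simp add: inner_diff_left inner_diff_right matrix_vector_mult_diff_distrib algebra_simps)
  also have "\<dots> \<le> (r + L) / 2 * ((norm (xs - xk))\<^sup>2 - (norm (xs - x'))\<^sup>2)
      + 1 / (2 * s) * ((norm (ys - yk))\<^sup>2 - (norm (ys - y'))\<^sup>2)
      + ((norm c)\<^sup>2 + (norm \<delta>)\<^sup>2) / (2 * r) + \<delta> \<bullet> (xs - xh)"
  proof -
    have "1 / (2 * s) * (norm (y' - yk))\<^sup>2 \<ge> 0"
      using pos by simp
    \<comment> \<open>The primal step supplies \<open>-(r + L)/2 |x' - xk|^2\<close>: its
      \<open>L\<close> part cancels the descent term, its \<open>r\<close> part is consumed by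
      \<open>aux\<close>. The dual displacement term has a favourable sign and is dropped.\<close>
    with dual primal aux young show ?thesis
      by (simp add: inner_diff_left inner_diff_right inner_add_left inner_add_right
          add_divide_distrib algebra_simps)
  qed
  finally show ?thesis
    unfolding c_def .
qed

section \<open>Sums over the step weights and the dual step in closed form\<close>

text \<open>Summation by parts: each increment of the nondecreasing weight multiplies some
  \<open>a k \<le> B\<close>, and the increments together with \<open>w 0\<close> add up to
  \<open>w t\<close>.\<close>

lemma weighted_telescope_le:
  fixes w a :: "nat \<Rightarrow> real"
  assumes "mono w" "w 0 \<ge> 0" "\<And>k. 0 \<le> a k" "\<And>k. a k \<le> B"
  shows "(\<Sum>k\<le>t. w k * (a k - a (Suc k))) \<le> w t * B"
proof -
  \<comment> \<open>The boundary term \<open>w t * a (Suc t)\<close> is kept so that the induction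
    closes; it is discarded at the end by its sign.\<close>
  have "(\<Sum>k\<le>t. w k * (a k - a (Suc k))) \<le> w t * B - w t * a (Suc t)"
  proof (induction t)
    case 0
    then show ?case
      using mult_left_mono[OF assms(4) assms(2), of 0] by (simp add: algebra_simps)
  next
    case (Suc t)
    have "(w (Suc t) - w t) * a (Suc t) \<le> (w (Suc t) - w t) * B"
      using monoD[OF \<open>mono w\<close>, of t "Suc t"] assms(4) by (intro mult_left_mono) auto
    with Suc show ?case by (simp add: algebra_simps)
  qed
  moreover have "w t \<ge> 0"
    using monoD[OF \<open>mono w\<close>, of 0 t] assms(2) by simp
  ultimately show ?thesis
    using assms(3)[of "Suc t"] by (smt (verit) mult_nonneg_nonneg)
qed

text \<open>The inductive step, with u and v the consecutive roots and v^2 = u^2 + 1, is the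
  expansion of (v - u)^2 \<ge> 0.\<close>

lemma sum_inverse_sqrt_le: "(\<Sum>k\<le>t. 1 / sqrt (real (Suc k))) \<le> 2 * sqrt (real (Suc t))"
proof (induction t)
  case 0
  then show ?case by simp
next
  case (Suc t)
  define u v where "u = sqrt (real (Suc t))" and "v = sqrt (real (Suc (Suc t)))"
  have "v\<^sup>2 = u\<^sup>2 + 1" "v > 0"
    by (simp_all add: u_def v_def)
  moreover have "0 \<le> (v - u)\<^sup>2"
    by simp
  ultimately have "2 * u + 1 / v \<le> 2 * v"
    by (simp add: field_simps power2_eq_square)
  with Suc show ?case
    by (simp add: u_def v_def del: of_nat_Suc)
qed

text \<open>Completing the square turns the objective into a constant minus a multiple of the
  squared distance to \<open>yk + s F x\<close>. As \<open>arg_max_on\<close> is a choice operator,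
  existence of a maximiser and uniqueness of the projection are both used.\<close>

lemma arg_max_on_eq_closest_point:
  fixes Y :: "(real^'l) set" and F :: "real^'d^'l"
  assumes Y: "convex Y" "closed Y" "Y \<noteq> {}" and s: "s > 0"
  shows "arg_max_on (\<lambda>y. saddle_P l F y x - (1 / (2 * s)) * (norm (y - yk))\<^sup>2) Y
    = closest_point Y (yk + s *\<^sub>R (F *v x))"
proof -
  let ?f = "\<lambda>y. saddle_P l F y x - (1 / (2 * s)) * (norm (y - yk))\<^sup>2"
  let ?a = "yk + s *\<^sub>R (F *v x)"
  have f: "?f y = l x + yk \<bullet> (F *v x) + s / 2 * (norm (F *v x))\<^sup>2 - 1 / (2 * s) * (dist ?a y)\<^sup>2" for y
    unfolding saddle_P_def dist_norm using s
    by (simp add: power2_norm_eq_inner inner_diff_left inner_diff_right inner_add_left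
        inner_add_right inner_commute field_simps power2_eq_square[of s])
  have le: "?f y \<le> ?f z \<longleftrightarrow> dist ?a z \<le> dist ?a y" for y z
    unfolding f using s by (simp add: field_simps)
  have "is_arg_max ?f (\<lambda>y. y \<in> Y) (closest_point Y ?a)"
    unfolding is_arg_max_linorder le
    using closest_point_in_set[OF Y(2,3)] closest_point_le[OF Y(2)] by blast
  then have "is_arg_max ?f (\<lambda>y. y \<in> Y) (arg_max_on ?f Y)"
    unfolding arg_max_on_def arg_max_def by (rule someI)
  then show ?thesis
    unfolding is_arg_max_linorder le using Y by (intro closest_point_unique) auto
qed

section \<open>The largest eigenvalue of a Gram matrix\<close>

text \<open>A zero of a nonnegative quadratic form is a minimiser, so its gradient vanishes there.
  Concretely, moving from \<open>v\<close> along \<open>- B v\<close> would make the form negative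
  for a small step.\<close>

lemma symmetric_psd_kernel:
  fixes B :: "real^'n^'n"
  assumes sym: "transpose B = B" and psd: "\<And>w. 0 \<le> w \<bullet> (B *v w)" and "v \<bullet> (B *v v) = 0"
  shows "B *v v = 0"
proof (rule ccontr)
  define u where "u = B *v v"
  define q where "q = u \<bullet> (B *v u)"
  assume "B *v v \<noteq> 0"
  then have pos: "u \<bullet> u > 0" by (simp add: u_def)
  have "v \<bullet> (B *v u) = u \<bullet> u"
    unfolding u_def by (metis dot_lmul_matrix sym transpose_matrix_vector)
  then have quad: "0 \<le> \<tau>\<^sup>2 * q - 2 * \<tau> * (u \<bullet> u)" for \<tau>
    using psd[of "v - \<tau> *\<^sub>R u"] assms(3)
    by (simp add: matrix_vector_mult_diff_distrib matrix_vector_mult_scaleR inner_diff_left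
        inner_diff_right q_def power2_eq_square algebra_simps flip: u_def)
  have "q \<ge> 0" unfolding q_def by (rule psd)
  \<comment> \<open>The step length \<open>u \<bullet> u / (q + 1)\<close> is short enough for the
    linear term to dominate; the added 1 keeps the denominator positive when
    \<open>q = 0\<close>.\<close>
  have "(u \<bullet> u / (q + 1)) * ((u \<bullet> u / (q + 1)) * q - 2 * (u \<bullet> u)) \<ge> 0"
    using quad[of "u \<bullet> u / (q + 1)"] by (simp add: power2_eq_square algebra_simps)
  moreover have "u \<bullet> u / (q + 1) > 0"
    using pos \<open>q \<ge> 0\<close> by simp
  ultimately have "(u \<bullet> u / (q + 1)) * q - 2 * (u \<bullet> u) \<ge> 0"
    by (metis zero_le_mult_iff not_less)
  moreover have "(u \<bullet> u / (q + 1)) * q \<le> u \<bullet> u"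
    using pos \<open>q \<ge> 0\<close> by (simp add: field_simps)
  ultimately show False
    using pos by linarith
qed

text \<open>Choose one eigenvector per eigenvalue: symmetry makes them pairwise orthogonal, and a
  pairwise orthogonal set in finite dimension is finite. This makes the \<open>Max\<close> in
  \<open>lambda_max\<close> meaningful.\<close>

lemma finite_eigenvalues_symmetric:
  fixes A :: "real^'n^'n"
  assumes "transpose A = A"
  shows "finite {\<mu>. \<exists>v. v \<noteq> 0 \<and> A *v v = \<mu> *\<^sub>R v}" (is "finite ?E")
proof -
  obtain f where f: "\<And>\<mu>. \<mu> \<in> ?E \<Longrightarrow> f \<mu> \<noteq> 0 \<and> A *v f \<mu> = \<mu> *\<^sub>R f \<mu>"
    using bchoice[of ?E "\<lambda>\<mu> v. v \<noteq> 0 \<and> A *v v = \<mu> *\<^sub>R v"] by auto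
  have orth: "f \<mu> \<bullet> f \<nu> = 0" if "\<mu> \<in> ?E" "\<nu> \<in> ?E" "\<mu> \<noteq> \<nu>" for \<mu> \<nu>
  proof -
    have "f \<mu> \<bullet> (A *v f \<nu>) = (A *v f \<mu>) \<bullet> f \<nu>"
      by (metis assms dot_lmul_matrix transpose_matrix_vector)
    then have "\<nu> * (f \<mu> \<bullet> f \<nu>) = \<mu> * (f \<mu> \<bullet> f \<nu>)"
      using f[OF that(1)] f[OF that(2)] by simp
    with that show ?thesis by simp
  qed
  have "inj_on f ?E"
  proof (rule inj_onI, rule ccontr)
    fix \<mu> \<nu> assume *: "\<mu> \<in> ?E" "\<nu> \<in> ?E" "f \<mu> = f \<nu>" "\<mu> \<noteq> \<nu>"
    with orth[of \<mu> \<nu>] f[of \<mu>] show False by simp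
  qed
  moreover have "finite (f ` ?E)"
    by (rule pairwise_orthogonal_imp_finite)
      (unfold pairwise_def orthogonal_def, use orth in blast)
  ultimately show ?thesis
    using finite_imageD by blast
qed

text \<open>Rayleigh quotient argument: let \<open>\<mu>\<close> be the maximum of |F w|^2 on the
  unit sphere, attained at \<open>u\<close>. Then \<open>\<mu> I - A\<close> is positive
  semidefinite and its form vanishes at \<open>u\<close>, so \<open>u\<close> is an eigenvector of
  \<open>A\<close> with eigenvalue \<open>\<mu>\<close>.\<close>

lemma norm_matrix_vector_le_lambda_max:
  fixes F :: "real^'d^'l"
  shows "(norm (F *v v))\<^sup>2 \<le> lambda_max (transpose F ** F) * (norm v)\<^sup>2"
proof -
  define A where "A = transpose F ** F"
  have sym: "transpose A = A"
    by (simp add: A_def matrix_transpose_mul)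
  have quad: "w \<bullet> (A *v w) = (norm (F *v w))\<^sup>2" for w
    unfolding A_def power2_norm_eq_inner
    by (metis dot_lmul_matrix inner_commute matrix_vector_mul_assoc transpose_matrix_vector)
  have "compact (sphere (0::real^'d) 1)" "sphere (0::real^'d) 1 \<noteq> {}"
    by auto
  moreover have "continuous_on (sphere (0::real^'d) 1) (\<lambda>w. (norm (F *v w))\<^sup>2)"
    by (intro continuous_intros)
  ultimately obtain u where u: "norm u = 1" "\<And>w. norm w = 1 \<Longrightarrow> (norm (F *v w))\<^sup>2 \<le> (norm (F *v u))\<^sup>2"
    using continuous_attains_sup by (metis (no_types, lifting) mem_sphere_0)
  define \<mu> where "\<mu> = (norm (F *v u))\<^sup>2"
  have bound: "(norm (F *v w))\<^sup>2 \<le> \<mu> * (norm w)\<^sup>2" for w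
  proof (cases "w = 0")
    case False
    then have "(norm (F *v ((1 / norm w) *\<^sub>R w)))\<^sup>2 \<le> \<mu>"
      unfolding \<mu>_def by (intro u) simp
    with False show ?thesis
      by (simp add: matrix_vector_mult_scaleR power_divide field_simps)
  qed simp
  define B where "B = \<mu> *\<^sub>R mat 1 - A"
  have B: "B *v w = \<mu> *\<^sub>R w - A *v w" for w
    by (simp add: B_def matrix_vector_mult_diff_rdistrib scaleR_matrix_vector_assoc[symmetric])
  have "transpose B = B"
    using sym by (simp add: B_def transpose_def vec_eq_iff mat_def)
  moreover have "0 \<le> w \<bullet> (B *v w)" for w
    using bound[of w] by (simp add: B inner_diff_right quad power2_norm_eq_inner)
  moreover have "u \<bullet> (B *v u) = 0"
    using u by (simp add: B inner_diff_right quad \<mu>_def norm_eq_1)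
  ultimately have "B *v u = 0"
    by (rule symmetric_psd_kernel)
  then have "A *v u = \<mu> *\<^sub>R u" "u \<noteq> 0"
    using u by (auto simp: B)
  then have "\<mu> \<le> lambda_max A"
    unfolding lambda_max_def by (intro Max_ge finite_eigenvalues_symmetric[OF sym]) auto
  then have "\<mu> * (norm v)\<^sup>2 \<le> lambda_max A * (norm v)\<^sup>2"
    by (intro mult_right_mono) auto
  with bound[of v] show ?thesis
    unfolding A_def by linarith
qed

lemma lambda_max_nonneg: "0 \<le> lambda_max (transpose F ** F)"
  for F :: "real^'d^'l"
proof -
  have "0 \<le> (norm (F *v axis undefined 1))\<^sup>2"
    by simp
  also have "\<dots> \<le> lambda_max (transpose F ** F) * (norm (axis undefined (1::real) :: real^'d))\<^sup>2"
    by (rule norm_matrix_vector_le_lambda_max)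
  finally show ?thesis
    by simp
qed

text \<open>The adjoint obeys the same operator bound: with w = F^T z, Cauchy-Schwarz gives |w|^2 =
  z \<bullet> F w \<le> |z| |F w|; square, bound |F w| and cancel |w|^2.\<close>

lemma norm_transpose_vector_le_lambda_max:
  fixes F :: "real^'d^'l"
  shows "(norm (transpose F *v z))\<^sup>2 \<le> lambda_max (transpose F ** F) * (norm z)\<^sup>2"
proof (cases "transpose F *v z = 0")
  case True
  then show ?thesis
    by (simp add: lambda_max_nonneg)
next
  case False
  define w where "w = transpose F *v z"
  have "(norm w)\<^sup>2 = z \<bullet> (F *v w)"
    unfolding w_def power2_norm_eq_inner by (metis dot_lmul_matrix transpose_matrix_vector)
  also have "\<dots> \<le> norm z * norm (F *v w)"
    by (rule norm_cauchy_schwarz)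
  finally have "((norm w)\<^sup>2)\<^sup>2 \<le> (norm z * norm (F *v w))\<^sup>2"
    by (intro power_mono) auto
  also have "\<dots> = (norm z)\<^sup>2 * (norm (F *v w))\<^sup>2"
    by (simp add: power_mult_distrib)
  also have "\<dots> \<le> (norm z)\<^sup>2 * (lambda_max (transpose F ** F) * (norm w)\<^sup>2)"
    by (intro mult_left_mono norm_matrix_vector_le_lambda_max) auto
  finally have "(norm w)\<^sup>2 * (norm w)\<^sup>2 \<le> (lambda_max (transpose F ** F) * (norm z)\<^sup>2) * (norm w)\<^sup>2"
    by (simp add: power2_eq_square algebra_simps)
  moreover have "(norm w)\<^sup>2 > 0"
    using False by (simp add: w_def)
  ultimately show ?thesis
    unfolding w_def[symmetric] by (metis mult_le_cancel_right_pos)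
qed

section \<open>Exponential moments\<close>

text \<open>For a centred variable the linear term integrates to zero, leaving only the exponential
  moment of the square. For \<open>x \<ge> 1\<close> compare exponents; otherwise go through 1 + x +
  x^2.\<close>

lemma exp_le_add_exp_square: "exp x \<le> x + exp (x\<^sup>2)" for x :: real
proof -
  have sq: "1 + x\<^sup>2 \<le> exp (x\<^sup>2)"
    by (rule exp_ge_add_one_self)
  consider "x \<ge> 1" | "0 \<le> x" "x \<le> 1" | "x \<le> 0"
    by linarith
  then show ?thesis
  proof cases
    case 1
    then have "exp x \<le> exp (x\<^sup>2)"
      by (simp add: self_le_power)
    with 1 show ?thesis by linarith
  next
    case 2
    then show ?thesis
      using exp_bound[of x] sq by linarith
  next
    case 3
    define u where "u = - x"
    have u: "u \<ge> 0" using 3 by (simp add: u_def)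
    then have "1 + u + u\<^sup>2 / 2 \<le> exp u"
      by (rule exp_lower_Taylor_quadratic)
    moreover have "0 \<le> (u - 1/2)\<^sup>2" by simp
    then have pos: "1 - u + u\<^sup>2 > 0"
      by (simp add: power2_eq_square algebra_simps)
    \<comment> \<open>The product of the quadratic Taylor polynomial with \<open>1 - u + u^2\<close>
      is 1 plus nonnegative terms, so \<open>1 - u + u^2\<close> bounds the reciprocal of
      \<open>exp u\<close>.\<close>
    ultimately have "(1 + u + u\<^sup>2 / 2) * (1 - u + u\<^sup>2) \<le> exp u * (1 - u + u\<^sup>2)"
      by (intro mult_right_mono) auto
    moreover have "(1 + u + u\<^sup>2 / 2) * (1 - u + u\<^sup>2) = 1 + u\<^sup>2 / 2 + u ^ 3 / 2 + u ^ 4 / 2"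
      by (simp add: power2_eq_square power3_eq_cube power4_eq_xxxx field_simps)
    moreover have "1 + u\<^sup>2 / 2 + u ^ 3 / 2 + u ^ 4 / 2 \<ge> 1"
      using u by simp
    ultimately have "1 \<le> exp u * (1 - u + u\<^sup>2)"
      by linarith
    then have "exp (- u) \<le> 1 - u + u\<^sup>2"
      by (simp add: exp_minus field_simps)
    then have "exp x \<le> 1 + x + x\<^sup>2"
      by (simp add: u_def)
    with sq show ?thesis by linarith
  qed
qed

text \<open>Convexity of exp between 0 and \<open>v - 1\<close>. The shift by 1 is matched to the
  hypothesis that the exponential moment is at most e: the bracket then has mean at most 1.\<close>

lemma exp_mult_le_affine:
  fixes w v :: real
  assumes "0 \<le> w" "w \<le> 1"
  shows "exp (w * v) \<le> exp w * ((1 - w) + w * exp (v - 1))"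
proof -
  have "exp ((1 - w) *\<^sub>R 0 + w *\<^sub>R (v - 1)) \<le> (1 - w) * exp 0 + w * exp (v - 1)"
    using exp_convex assms by (intro convex_onD[of UNIV]) auto
  then have "exp w * exp (w * (v - 1)) \<le> exp w * ((1 - w) + w * exp (v - 1))"
    by simp
  then show ?thesis
    by (simp add: exp_add[symmetric] algebra_simps)
qed

text \<open>Jensen's inequality for the concave power \<open>w\<close>, obtained by integrating the
  pointwise affine bound.\<close>

lemma (in prob_space) nn_integral_exp_mult_le:
  assumes [measurable]: "Z \<in> borel_measurable M"
    and Z: "(\<integral>\<^sup>+ z. ennreal (exp (Z z)) \<partial>M) \<le> ennreal (exp 1)"
    and w: "0 \<le> w" "w \<le> 1"
  shows "(\<integral>\<^sup>+ z. ennreal (exp (w * Z z)) \<partial>M) \<le> ennreal (exp w)"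
proof -
  have "(\<integral>\<^sup>+ z. ennreal (exp (w * Z z)) \<partial>M)
      \<le> (\<integral>\<^sup>+ z. ennreal (exp w * (1 - w)) + ennreal (exp w * w * exp (-1)) * ennreal (exp (Z z)) \<partial>M)"
  proof (rule nn_integral_mono)
    fix z
    have "exp (w * Z z) \<le> exp w * (1 - w) + exp w * w * exp (-1) * exp (Z z)"
      using exp_mult_le_affine[OF w, of "Z z"] by (simp add: exp_diff exp_minus field_simps)
    then show "ennreal (exp (w * Z z)) \<le> ennreal (exp w * (1 - w)) + ennreal (exp w * w * exp (-1)) * ennreal (exp (Z z))"
      using w by (simp flip: ennreal_plus ennreal_mult)
  qed
  also have "\<dots> = ennreal (exp w * (1 - w)) + ennreal (exp w * w * exp (-1)) * (\<integral>\<^sup>+ z. ennreal (exp (Z z)) \<partial>M)"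
    by (simp add: nn_integral_add nn_integral_cmult emeasure_space_1)
  also have "\<dots> \<le> ennreal (exp w * (1 - w)) + ennreal (exp w * w * exp (-1)) * ennreal (exp 1)"
    by (intro add_left_mono mult_left_mono Z) auto
  also have "\<dots> = ennreal (exp w)"
    using w by (simp flip: ennreal_plus ennreal_mult add: exp_minus field_simps)
  finally show ?thesis .
qed

text \<open>Two regimes. If \<theta>^2 v^2 \<le> 1, the linear term has mean zero and the square is
  handled with exponent weight \<theta>^2 v^2. Otherwise Young's inequality gives exponent
  \<theta>^2 v^2 / 2 + 1/2, which is below \<theta>^2 v^2.\<close>

lemma (in prob_space) sub_gaussian_mgf:
  fixes Z :: "'a \<Rightarrow> real"
  assumes int: "integrable M Z" "expectation Z = 0" and v: "v > 0"
    and sg: "(\<integral>\<^sup>+ z. ennreal (exp ((Z z)\<^sup>2 / v\<^sup>2)) \<partial>M) \<le> ennreal (exp 1)"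
  shows "(\<integral>\<^sup>+ z. ennreal (exp (\<theta> * Z z)) \<partial>M) \<le> ennreal (exp (\<theta>\<^sup>2 * v\<^sup>2))"
proof (cases "\<theta>\<^sup>2 * v\<^sup>2 \<le> 1")
  case True
  have [measurable]: "Z \<in> borel_measurable M"
    using int by auto
  let ?w = "\<theta>\<^sup>2 * v\<^sup>2"
  have "(\<integral>\<^sup>+ z. ennreal (exp (?w * ((Z z)\<^sup>2 / v\<^sup>2))) \<partial>M) \<le> ennreal (exp ?w)"
    using True sg by (intro nn_integral_exp_mult_le) auto
  then have sq: "(\<integral>\<^sup>+ z. ennreal (exp ((\<theta> * Z z)\<^sup>2)) \<partial>M) \<le> ennreal (exp ?w)"
    using v by (simp add: power_mult_distrib)
  have int2: "integrable M (\<lambda>z. exp ((\<theta> * Z z)\<^sup>2))"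
    using le_less_trans[OF sq] by (intro integrableI_nonneg) auto
  have "(\<integral>\<^sup>+ z. ennreal (exp (\<theta> * Z z)) \<partial>M) \<le> (\<integral>\<^sup>+ z. ennreal (\<theta> * Z z + exp ((\<theta> * Z z)\<^sup>2)) \<partial>M)"
    by (intro nn_integral_mono ennreal_leI exp_le_add_exp_square)
  also have "\<dots> = ennreal (\<integral>z. \<theta> * Z z + exp ((\<theta> * Z z)\<^sup>2) \<partial>M)"
    using int int2 by (intro nn_integral_eq_integral)
      (auto intro!: AE_I2 order_trans[OF _ exp_le_add_exp_square])
  also have "(\<integral>z. \<theta> * Z z + exp ((\<theta> * Z z)\<^sup>2) \<partial>M) = (\<integral>z. exp ((\<theta> * Z z)\<^sup>2) \<partial>M)"
    using int int2 by simp
  also have "ennreal \<dots> = (\<integral>\<^sup>+ z. ennreal (exp ((\<theta> * Z z)\<^sup>2)) \<partial>M)"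
    using int2 by (intro nn_integral_eq_integral[symmetric]) auto
  finally show ?thesis using sq by order
next
  case False
  have [measurable]: "Z \<in> borel_measurable M"
    using int by auto
  let ?w = "\<theta>\<^sup>2 * v\<^sup>2"
  have "(\<integral>\<^sup>+ z. ennreal (exp (\<theta> * Z z)) \<partial>M)
      \<le> (\<integral>\<^sup>+ z. ennreal (exp (?w / 2)) * ennreal (exp (1/2 * ((Z z)\<^sup>2 / v\<^sup>2))) \<partial>M)"
  proof (rule nn_integral_mono)
    fix z
    have "0 \<le> (\<theta> * v - Z z / v)\<^sup>2"
      by simp
    then have "\<theta> * Z z \<le> ?w / 2 + 1/2 * ((Z z)\<^sup>2 / v\<^sup>2)"
      using v by (simp add: power2_diff power_mult_distrib power_divide)
    then show "ennreal (exp (\<theta> * Z z)) \<le> ennreal (exp (?w / 2)) * ennreal (exp (1/2 * ((Z z)\<^sup>2 / v\<^sup>2)))"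
      by (simp flip: ennreal_mult exp_add)
  qed
  also have "\<dots> = ennreal (exp (?w / 2)) * (\<integral>\<^sup>+ z. ennreal (exp (1/2 * ((Z z)\<^sup>2 / v\<^sup>2))) \<partial>M)"
    by (intro nn_integral_cmult) auto
  also have "\<dots> \<le> ennreal (exp (?w / 2)) * ennreal (exp (1/2))"
    using sg by (intro mult_left_mono nn_integral_exp_mult_le) auto
  also have "\<dots> \<le> ennreal (exp ?w)"
    using False by (simp flip: ennreal_mult exp_add)
  finally show ?thesis .
qed

section \<open>Tail bounds for sums adapted to independent samples\<close>

text \<open>Increment \<open>k\<close> may depend on the past samples, but its exponential moment
  over the fresh one is bounded uniformly in the past. Independence and Fubini integrate out the
  last sample with the past frozen, in place of a conditional expectation.\<close>

lemma (in prob_space) nn_integral_exp_sum_indep_le: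
  fixes h :: "nat \<Rightarrow> (nat \<Rightarrow> 's) \<Rightarrow> 's \<Rightarrow> real"
  assumes indep: "indep_vars (\<lambda>_. N) \<xi> UNIV" and Q: "\<And>k. distr M N (\<xi> k) = Q"
    and h: "\<And>k. (\<lambda>(u, z). h k u z) \<in> borel_measurable (PiM {..<k} (\<lambda>_. N) \<Otimes>\<^sub>M N)"
    and bd: "\<And>k u. u \<in> space (PiM {..<k} (\<lambda>_. N)) \<Longrightarrow>
               (\<integral>\<^sup>+ z. ennreal (exp (h k u z)) \<partial>Q) \<le> ennreal (exp (c k))"
  shows "(\<integral>\<^sup>+ \<omega>. ennreal (exp (\<Sum>k<n. h k (restrict (\<lambda>j. \<xi> j \<omega>) {..<k}) (\<xi> k \<omega>))) \<partial>M)
     \<le> ennreal (exp (\<Sum>k<n. c k))"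
proof (induction n)
  case 0
  then show ?case by (simp add: emeasure_space_1)
next
  case (Suc n)
  let ?P = "PiM {..<n} (\<lambda>_. N)"
  define U where "U = (\<lambda>\<omega>. restrict (\<lambda>j. \<xi> j \<omega>) {..<n})"
  define H where "H = (\<lambda>u. \<Sum>k<n. h k (restrict u {..<k}) (u k))"
  have \<xi>[measurable]: "\<xi> k \<in> measurable M N" for k
    using indep by (simp add: indep_vars_def)
  have U[measurable]: "U \<in> measurable M ?P"
    unfolding U_def by measurable
  have H[measurable]: "H \<in> borel_measurable ?P"
    unfolding H_def
  proof (intro borel_measurable_sum)
    fix k assume k: "k \<in> {..<n}"
    have "(\<lambda>u. (restrict u {..<k}, u k)) \<in> measurable ?P (PiM {..<k} (\<lambda>_. N) \<Otimes>\<^sub>M N)"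
      using k by (intro measurable_Pair measurable_restrict_subset measurable_component_singleton) auto
    from measurable_compose[OF this h] show "(\<lambda>u. h k (restrict u {..<k}) (u k)) \<in> borel_measurable ?P"
      by simp
  qed
  have sum_eq: "(\<Sum>k<n. h k (restrict (\<lambda>j. \<xi> j \<omega>) {..<k}) (\<xi> k \<omega>)) = H (U \<omega>)" for \<omega>
    unfolding H_def U_def by (intro sum.cong) (auto intro!: arg_cong2[where f="h _"] simp: restrict_def fun_eq_iff)
  let ?S = "PiM {n} (\<lambda>_. N)"
  \<comment> \<open>The fresh sample is packed as a one-coordinate tuple, because independence is
    available between restrictions to disjoint index sets; it is read back as
    \<open>v n\<close>.\<close>
  define V where "V = (\<lambda>\<omega>. restrict (\<lambda>j. \<xi> j \<omega>) {n})"
  have V[measurable]: "V \<in> measurable M ?S"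
    unfolding V_def by measurable
  have "indep_var ?P U ?S V"
    unfolding U_def V_def using indep by (intro indep_var_restrict[of _ _ UNIV]) auto
  then have distr: "distr M (?P \<Otimes>\<^sub>M ?S) (\<lambda>\<omega>. (U \<omega>, V \<omega>)) = distr M ?P U \<Otimes>\<^sub>M distr M ?S V"
    unfolding indep_var_distribution_eq by simp
  interpret PV: prob_space "distr M ?S V"
    by (rule prob_space_distr) fact
  have nth[measurable]: "(\<lambda>v. v n) \<in> measurable ?S N"
    by (intro measurable_component_singleton) simp
  have hn[measurable]: "(\<lambda>(u, z). h n u z) \<in> borel_measurable (?P \<Otimes>\<^sub>M N)"
    by (rule h)
  have "(\<integral>\<^sup>+ \<omega>. ennreal (exp (\<Sum>k<Suc n. h k (restrict (\<lambda>j. \<xi> j \<omega>) {..<k}) (\<xi> k \<omega>))) \<partial>M)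
      = (\<integral>\<^sup>+ \<omega>. (\<lambda>(u, v). ennreal (exp (H u)) * ennreal (exp (h n u (v n)))) (U \<omega>, V \<omega>) \<partial>M)"
    by (simp add: sum_eq exp_add ennreal_mult V_def) (simp add: U_def)
  also have "\<dots> = (\<integral>\<^sup>+ p. (\<lambda>(u, v). ennreal (exp (H u)) * ennreal (exp (h n u (v n)))) p
      \<partial>(distr M ?P U \<Otimes>\<^sub>M distr M ?S V))"
    unfolding distr[symmetric] by (subst nn_integral_distr) measurable
  also have "\<dots> = (\<integral>\<^sup>+ u. \<integral>\<^sup>+ v. ennreal (exp (H u)) * ennreal (exp (h n u (v n))) \<partial>distr M ?S V \<partial>distr M ?P U)"
  proof -
    have "(\<lambda>(u, v). ennreal (exp (H u)) * ennreal (exp (h n u (v n))))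
        \<in> borel_measurable (distr M ?P U \<Otimes>\<^sub>M distr M ?S V)"
      by measurable
    from PV.nn_integral_fst[OF this] show ?thesis by simp
  qed
  also have "\<dots> \<le> (\<integral>\<^sup>+ u. ennreal (exp (H u)) * ennreal (exp (c n)) \<partial>distr M ?P U)"
  proof (rule nn_integral_mono)
    fix u assume "u \<in> space (distr M ?P U)"
    then have u: "u \<in> space ?P" by simp
    have hu[measurable]: "h n u \<in> borel_measurable N"
      using measurable_compose[OF measurable_Pair1'[OF u] hn] by simp
    have "(\<integral>\<^sup>+ v. ennreal (exp (H u)) * ennreal (exp (h n u (v n))) \<partial>distr M ?S V)
        = ennreal (exp (H u)) * (\<integral>\<^sup>+ v. ennreal (exp (h n u (v n))) \<partial>distr M ?S V)"
      by (intro nn_integral_cmult) measurable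
    also have "(\<integral>\<^sup>+ v. ennreal (exp (h n u (v n))) \<partial>distr M ?S V)
        = (\<integral>\<^sup>+ \<omega>. ennreal (exp (h n u (\<xi> n \<omega>))) \<partial>M)"
      by (subst nn_integral_distr) (auto simp: V_def)
    also have "\<dots> = (\<integral>\<^sup>+ z. ennreal (exp (h n u z)) \<partial>Q)"
      unfolding Q[of n, symmetric] using hu by (simp add: nn_integral_distr)
    also have "ennreal (exp (H u)) * \<dots> \<le> ennreal (exp (H u)) * ennreal (exp (c n))"
      by (intro mult_left_mono bd u) auto
    finally show "(\<integral>\<^sup>+ v. ennreal (exp (H u)) * ennreal (exp (h n u (v n))) \<partial>distr M ?S V)
        \<le> ennreal (exp (H u)) * ennreal (exp (c n))" .
  qed
  also have "\<dots> = (\<integral>\<^sup>+ \<omega>. ennreal (exp (H (U \<omega>))) \<partial>M) * ennreal (exp (c n))"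
    by (subst nn_integral_distr) (auto simp: nn_integral_multc)
  also have "\<dots> \<le> ennreal (exp (\<Sum>k<n. c k)) * ennreal (exp (c n))"
    using Suc.IH unfolding sum_eq by (intro mult_right_mono) auto
  also have "\<dots> = ennreal (exp (\<Sum>k<Suc n. c k))"
    by (simp add: exp_add flip: ennreal_mult)
  finally show ?case .
qed

text \<open>Chernoff bound: Markov's inequality for \<open>exp (\<theta> * S)\<close>.\<close>

lemma (in prob_space) prob_gt_le_exp:
  assumes [measurable]: "S \<in> borel_measurable M"
    and "(\<integral>\<^sup>+ \<omega>. ennreal (exp (\<theta> * S \<omega>)) \<partial>M) \<le> ennreal (exp c)" "\<theta> > 0"
  shows "prob {\<omega> \<in> space M. S \<omega> > r} \<le> exp (c - \<theta> * r)"
proof -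
  have "emeasure M {\<omega> \<in> space M. S \<omega> > r}
      \<le> emeasure M {\<omega> \<in> space M. 1 \<le> ennreal (exp (- \<theta> * r)) * ennreal (exp (\<theta> * S \<omega>))}"
    using \<open>\<theta> > 0\<close> by (intro emeasure_mono) (auto simp flip: ennreal_mult exp_add ennreal_1)
  also have "\<dots> = emeasure M ({\<omega> \<in> space M. 1 \<le> ennreal (exp (- \<theta> * r)) * ennreal (exp (\<theta> * S \<omega>))} \<inter> space M)"
    by (intro arg_cong[where f="emeasure M"]) auto
  also have "\<dots> \<le> ennreal (exp (- \<theta> * r)) * (\<integral>\<^sup>+ \<omega>. ennreal (exp (\<theta> * S \<omega>)) \<partial>M)"
    using nn_integral_Markov_inequality[of "\<lambda>\<omega>. ennreal (exp (\<theta> * S \<omega>))" "space M" M "ennreal (exp (- \<theta> * r))"]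
    by (simp add: Int_def conj_commute cong: nn_integral_cong)
  also have "\<dots> \<le> ennreal (exp (- \<theta> * r)) * ennreal (exp c)"
    by (intro mult_left_mono assms) auto
  also have "\<dots> = ennreal (exp (c - \<theta> * r))"
    by (simp flip: ennreal_mult exp_add)
  finally show ?thesis
    by (simp add: emeasure_eq_measure)
qed

section \<open>The iteration\<close>

locale spdhg_setting =
  fixes X :: "(real^'d) set" and Y :: "(real^'l) set" and F :: "real^'d^'l"
    and l :: "real^'d \<Rightarrow> real" and gl :: "real^'d \<Rightarrow> real^'d"
    and G :: "real^'d \<Rightarrow> 's \<Rightarrow> real^'d"
    and L s :: real and x0 xstar :: "real^'d" and y0 ystar :: "real^'l"
  assumes X: "convex X" "compact X" and Y: "convex Y" "compact Y"
    and l_convex: "convex_on X l"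
    and l_grad: "\<forall>x\<in>X. (l has_derivative (\<lambda>h. gl x \<bullet> h)) (at x within X)"
    and gl_cont: "continuous_on X gl"
    and L: "L \<ge> 0" "\<forall>x1\<in>X. \<forall>x2\<in>X. norm (gl x1 - gl x2) \<le> L * norm (x1 - x2)"
    and s: "s > 0"
    and init: "x0 \<in> X" "y0 \<in> Y" and star: "xstar \<in> X" "ystar \<in> Y"
begin

definition step_size :: "nat \<Rightarrow> real" where
  "step_size k = 1 / (sqrt (real k) + L)"

definition iterate :: "(nat \<Rightarrow> 's) \<Rightarrow> nat \<Rightarrow> (real^'l) \<times> (real^'d)" where
  "iterate u k = spdhg l G F X Y s step_size x0 y0 u k"

text \<open>y^{k+1} in projection form. It is computed from the k-th iterate, hence from the first k
  samples, which is why \<open>predictable_point\<close> may use it.\<close>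

definition dual_next :: "nat \<Rightarrow> (nat \<Rightarrow> 's) \<Rightarrow> real^'l" where
  "dual_next k u = closest_point Y (fst (iterate u k) + s *\<^sub>R (F *v snd (iterate u k)))"

text \<open>The fresh sample is an argument separate from the history, so that it can be integrated
  while the history is fixed.\<close>

definition noise :: "nat \<Rightarrow> (nat \<Rightarrow> 's) \<Rightarrow> 's \<Rightarrow> real^'d" where
  "noise k u z = G (snd (iterate u k)) z - gl (snd (iterate u k))"

text \<open>Replaces x^{k+1} in the inner product with the noise; unlike x^{k+1} it does not depend
  on the sample xi^{k+1}.\<close>
definition predictable_point :: "nat \<Rightarrow> (nat \<Rightarrow> 's) \<Rightarrow> real^'d" where
  "predictable_point k u = closest_point X (snd (iterate u k)
     + (1 / sqrt (real (Suc k))) *\<^sub>R (transpose F *v (ystar - dual_next k u)))"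

lemma closed: "closed X" "closed Y" and nonempty: "X \<noteq> {}" "Y \<noteq> {}"
  using X Y init compact_imp_closed by auto

lemma iterate_0: "iterate u 0 = (y0, x0)"
  by (simp add: iterate_def)

lemma iterate_Suc:
  "iterate u (Suc k) = (dual_next k u, closest_point X (snd (iterate u k) - step_size (Suc k) *\<^sub>R
     (G (snd (iterate u k)) (u k) + transpose F *v dual_next k u)))"
  unfolding dual_next_def iterate_def spdhg.simps Let_def split_beta
    arg_max_on_eq_closest_point[OF Y(1) closed(2) nonempty(2) s] by simp

lemma iterate_in: "snd (iterate u k) \<in> X" "fst (iterate u k) \<in> Y"
  using init closest_point_in_set[OF closed(1) nonempty(1)] closest_point_in_set[OF closed(2) nonempty(2)]
  by (cases k; simp add: iterate_0 iterate_Suc dual_next_def)+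

lemma predictable_point_in: "predictable_point k u \<in> X"
  unfolding predictable_point_def using closest_point_in_set closed nonempty by blast

lemma iterate_cong: "(\<And>j. j < k \<Longrightarrow> u j = v j) \<Longrightarrow> iterate u k = iterate v k"
  by (induction k) (simp_all add: iterate_0 iterate_Suc dual_next_def)

text \<open>By causality the sample sequence can be cut to its first k entries, the form in which
  the exponential-moment lemma takes its increments.\<close>

lemma noise_restrict: "noise k (restrict u {..<k}) z = noise k u z"
  and predictable_point_restrict: "predictable_point k (restrict u {..<k}) = predictable_point k u"
  using iterate_cong[of k "restrict u {..<k}" u]
  by (simp_all add: noise_def predictable_point_def dual_next_def)

section \<open>Deterministic bound on the averaged saddle gap\<close>

lemma saddle_gap_step:
  "saddle_P l F ystar (snd (iterate u (Suc k))) - saddle_P l F (fst (iterate u (Suc k))) xstar \<le>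
      (sqrt (real (Suc k)) + L) / 2 * ((norm (xstar - snd (iterate u k)))\<^sup>2 - (norm (xstar - snd (iterate u (Suc k))))\<^sup>2)
      + 1 / (2 * s) * ((norm (ystar - fst (iterate u k)))\<^sup>2 - (norm (ystar - fst (iterate u (Suc k))))\<^sup>2)
      + ((norm (transpose F *v (ystar - dual_next k u)))\<^sup>2 + (norm (noise k u (u k)))\<^sup>2) / (2 * sqrt (real (Suc k)))
      + noise k u (u k) \<bullet> (xstar - predictable_point k u)"
proof -
  have G: "gl (snd (iterate u k)) + noise k u (u k) = G (snd (iterate u k)) (u k)"
    by (simp add: noise_def)
  have "0 < sqrt (real (Suc k))"
    by simp
  from primal_dual_step[OF X(1) closed(1) Y(1) closed(2) l_convex l_grad L s this iterate_in(1)[of u k] star,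
      where \<delta> = "noise k u (u k)" and yk = "fst (iterate u k)" and F = F]
  show ?thesis
    unfolding iterate_Suc fst_conv snd_conv predictable_point_def step_size_def
    by (simp only: G flip: dual_next_def)
qed

text \<open>The gap at the averages is at most the average gap, since \<open>saddle_P\<close> is
  convex in x and affine in y. Summing the step inequality leaves telescoping sums, a coupling sum
  bounded by the operator norm of F^T, and two noise sums that carry all the remaining
  randomness.\<close>

lemma saddle_gap_average_le:
  fixes t :: nat and u :: "nat \<Rightarrow> 's"
  defines "T \<equiv> real (t + 1)"
  shows "saddle_P l F ystar (\<Sum>k\<le>t. (1 / T) *\<^sub>R snd (iterate u (Suc k)))
      - saddle_P l F (\<Sum>k\<le>t. (1 / T) *\<^sub>R fst (iterate u (Suc k))) xstar \<le>
    1 / T * ((sqrt T + L) / 2 * (diameter X)\<^sup>2 + (diameter Y)\<^sup>2 / (2 * s)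
      + lambda_max (transpose F ** F) * (diameter Y)\<^sup>2 * sqrt T
      + (\<Sum>k\<le>t. (norm (noise k u (u k)))\<^sup>2 / (2 * sqrt (real (Suc k))))
      + (\<Sum>k\<le>t. noise k u (u k) \<bullet> (xstar - predictable_point k u)))"
proof -
  let ?x = "\<lambda>k. snd (iterate u k)" and ?y = "\<lambda>k. fst (iterate u k)"
  let ?\<Lambda> = "lambda_max (transpose F ** F)"
  have F: "v \<bullet> (F *v w) = (transpose F *v v) \<bullet> w" for v w
    by (metis dot_lmul_matrix inner_commute transpose_matrix_vector)
  have T: "T > 0" by (simp add: T_def)
  have sumT: "(\<Sum>k\<le>t. 1 / T) = 1"
    by (simp add: T_def)
  have "l (\<Sum>k\<le>t. (1 / T) *\<^sub>R ?x (Suc k)) \<le> (\<Sum>k\<le>t. 1 / T * l (?x (Suc k)))"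
    using T sumT iterate_in by (intro convex_on_sum[OF _ _ l_convex]) auto
  then have "saddle_P l F ystar (\<Sum>k\<le>t. (1 / T) *\<^sub>R ?x (Suc k)) \<le> (\<Sum>k\<le>t. 1 / T * saddle_P l F ystar (?x (Suc k)))"
    by (simp add: saddle_P_def F inner_sum_right sum.distrib distrib_left add_divide_distrib)
  moreover have "saddle_P l F (\<Sum>k\<le>t. (1 / T) *\<^sub>R ?y (Suc k)) xstar = (\<Sum>k\<le>t. 1 / T * saddle_P l F (?y (Suc k)) xstar)"
  proof -
    have "(\<Sum>k\<le>t. 1 / T * l xstar) = l xstar"
      using sumT unfolding sum_distrib_right[symmetric] by simp
    then show ?thesis
      by (simp add: saddle_P_def inner_sum_left sum.distrib distrib_left add_divide_distrib)
  qed
  ultimately have "saddle_P l F ystar (\<Sum>k\<le>t. (1 / T) *\<^sub>R ?x (Suc k)) - saddle_P l F (\<Sum>k\<le>t. (1 / T) *\<^sub>R ?y (Suc k)) xstar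
      \<le> 1 / T * (\<Sum>k\<le>t. saddle_P l F ystar (?x (Suc k)) - saddle_P l F (?y (Suc k)) xstar)"
    by (simp add: sum_subtractf right_diff_distrib diff_divide_distrib sum_divide_distrib)
  also have "\<dots> \<le> 1 / T * (
      (\<Sum>k\<le>t. (sqrt (real (Suc k)) + L) / 2 * ((norm (xstar - ?x k))\<^sup>2 - (norm (xstar - ?x (Suc k)))\<^sup>2))
      + (\<Sum>k\<le>t. 1 / (2 * s) * ((norm (ystar - ?y k))\<^sup>2 - (norm (ystar - ?y (Suc k)))\<^sup>2))
      + (\<Sum>k\<le>t. (norm (transpose F *v (ystar - dual_next k u)))\<^sup>2 / (2 * sqrt (real (Suc k))))
      + (\<Sum>k\<le>t. (norm (noise k u (u k)))\<^sup>2 / (2 * sqrt (real (Suc k))))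
      + (\<Sum>k\<le>t. noise k u (u k) \<bullet> (xstar - predictable_point k u)))"
    unfolding sum.distrib[symmetric] add_divide_distrib[symmetric]
  proof (intro mult_left_mono sum_mono)
    fix k
    show "saddle_P l F ystar (?x (Suc k)) - saddle_P l F (?y (Suc k)) xstar \<le>
      (sqrt (real (Suc k)) + L) / 2 * ((norm (xstar - ?x k))\<^sup>2 - (norm (xstar - ?x (Suc k)))\<^sup>2)
      + 1 / (2 * s) * ((norm (ystar - ?y k))\<^sup>2 - (norm (ystar - ?y (Suc k)))\<^sup>2)
      + (norm (transpose F *v (ystar - dual_next k u)))\<^sup>2 / (2 * sqrt (real (Suc k)))
      + (norm (noise k u (u k)))\<^sup>2 / (2 * sqrt (real (Suc k)))
      + noise k u (u k) \<bullet> (xstar - predictable_point k u)"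
      using saddle_gap_step[of u k] by (simp add: add_divide_distrib)
  qed (use T in simp)
  also have "\<dots> \<le> 1 / T * ((sqrt T + L) / 2 * (diameter X)\<^sup>2 + (diameter Y)\<^sup>2 / (2 * s)
      + ?\<Lambda> * (diameter Y)\<^sup>2 * sqrt T
      + (\<Sum>k\<le>t. (norm (noise k u (u k)))\<^sup>2 / (2 * sqrt (real (Suc k))))
      + (\<Sum>k\<le>t. noise k u (u k) \<bullet> (xstar - predictable_point k u)))"
  proof (intro mult_left_mono add_right_mono add_mono)
    have dX: "norm (xstar - ?x k) \<le> diameter X" for k
      using diameter_bounded_bound[OF compact_imp_bounded[OF X(2)] star(1) iterate_in(1)]
      by (simp add: dist_norm)
    have dY: "norm (ystar - ?y k) \<le> diameter Y" for k
      using diameter_bounded_bound[OF compact_imp_bounded[OF Y(2)] star(2) iterate_in(2)]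
      by (simp add: dist_norm)
    show "(\<Sum>k\<le>t. (sqrt (real (Suc k)) + L) / 2 * ((norm (xstar - ?x k))\<^sup>2 - (norm (xstar - ?x (Suc k)))\<^sup>2))
        \<le> (sqrt T + L) / 2 * (diameter X)\<^sup>2"
      \<comment> \<open>The inverse step sizes increase with k, so only the last weight
        \<open>(sqrt T + L) / 2\<close> survives.\<close>
      using weighted_telescope_le[of "\<lambda>k. (sqrt (real (Suc k)) + L) / 2" "\<lambda>k. (norm (xstar - ?x k))\<^sup>2"
          "(diameter X)\<^sup>2" t] L dX
      by (simp add: T_def mono_def power_mono add.commute)
    show "(\<Sum>k\<le>t. 1 / (2 * s) * ((norm (ystar - ?y k))\<^sup>2 - (norm (ystar - ?y (Suc k)))\<^sup>2))
        \<le> (diameter Y)\<^sup>2 / (2 * s)"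
      using weighted_telescope_le[of "\<lambda>k. 1 / (2 * s)" "\<lambda>k. (norm (ystar - ?y k))\<^sup>2" "(diameter Y)\<^sup>2" t] s dY
      by (simp add: mono_def power_mono)
    have y: "(norm (transpose F *v (ystar - dual_next k u)))\<^sup>2 \<le> ?\<Lambda> * (diameter Y)\<^sup>2" for k
    proof -
      have "(norm (transpose F *v (ystar - dual_next k u)))\<^sup>2 \<le> ?\<Lambda> * (norm (ystar - dual_next k u))\<^sup>2"
        by (rule norm_transpose_vector_le_lambda_max)
      also have "\<dots> \<le> ?\<Lambda> * (diameter Y)\<^sup>2"
        using dY[of "Suc k"] by (intro mult_left_mono power_mono lambda_max_nonneg) (simp_all add: iterate_Suc)
      finally show ?thesis .
    qed
    have "(\<Sum>k\<le>t. (norm (transpose F *v (ystar - dual_next k u)))\<^sup>2 / (2 * sqrt (real (Suc k))))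
        \<le> (\<Sum>k\<le>t. ?\<Lambda> * (diameter Y)\<^sup>2 / (2 * sqrt (real (Suc k))))"
      by (intro sum_mono divide_right_mono y) auto
    also have "\<dots> = ?\<Lambda> * (diameter Y)\<^sup>2 / 2 * (\<Sum>k\<le>t. 1 / sqrt (real (Suc k)))"
      by (simp add: sum_distrib_left del: of_nat_Suc)
    also have "\<dots> \<le> ?\<Lambda> * (diameter Y)\<^sup>2 / 2 * (2 * sqrt (real (Suc t)))"
      by (intro mult_left_mono sum_inverse_sqrt_le) (simp add: lambda_max_nonneg)
    finally show "(\<Sum>k\<le>t. (norm (transpose F *v (ystar - dual_next k u)))\<^sup>2 / (2 * sqrt (real (Suc k))))
        \<le> ?\<Lambda> * (diameter Y)\<^sup>2 * sqrt T"
      by (simp add: T_def add.commute)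
  qed (use T in simp)
  finally show ?thesis .
qed

section \<open>Measurability in the sample history\<close>

text \<open>The product space over \<open>{..<n}\<close> stays fixed while \<open>k\<close> runs up
  to \<open>n\<close>, so the induction never changes the sigma-algebra; projections and linear maps
  are continuous.\<close>

lemma borel_measurable_iterate:
  assumes G_meas: "(\<lambda>(x, z). G x z) \<in> borel_measurable (borel \<Otimes>\<^sub>M N)" and "k \<le> n"
  shows "(\<lambda>u. fst (iterate u k)) \<in> borel_measurable (PiM {..<n} (\<lambda>_. N))"
    and "(\<lambda>u. snd (iterate u k)) \<in> borel_measurable (PiM {..<n} (\<lambda>_. N))"
    and "dual_next k \<in> borel_measurable (PiM {..<n} (\<lambda>_. N))"
proof -
  let ?P = "PiM {..<n} (\<lambda>_. N)"
  have [measurable]: "closest_point X \<in> borel_measurable borel" "closest_point Y \<in> borel_measurable borel"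
    using X Y closed nonempty by (auto intro!: borel_measurable_continuous_onI continuous_on_closest_point)
  have [measurable]: "(\<lambda>w. F *v w) \<in> borel_measurable borel" "(\<lambda>w. transpose F *v w) \<in> borel_measurable borel"
    by (intro borel_measurable_continuous_onI matrix_vector_mult_linear_continuous_on)+
  have dual: "dual_next k \<in> borel_measurable ?P"
    if [measurable]: "(\<lambda>u. fst (iterate u k)) \<in> borel_measurable ?P" "(\<lambda>u. snd (iterate u k)) \<in> borel_measurable ?P" for k
    unfolding dual_next_def by measurable
  have "(\<lambda>u. fst (iterate u k)) \<in> borel_measurable ?P \<and> (\<lambda>u. snd (iterate u k)) \<in> borel_measurable ?P"
    using \<open>k \<le> n\<close>
  proof (induction k)
    case 0
    then show ?case by (simp add: iterate_0)
  next
    case (Suc k)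
    then have [measurable]: "(\<lambda>u. snd (iterate u k)) \<in> borel_measurable ?P" "dual_next k \<in> borel_measurable ?P"
      using dual by auto
    have "(\<lambda>u. u k) \<in> measurable ?P N"
      using Suc.prems by (intro measurable_component_singleton) auto
    then have "(\<lambda>u. (snd (iterate u k), u k)) \<in> measurable ?P (borel \<Otimes>\<^sub>M N)"
      by measurable
    from measurable_compose[OF this G_meas]
    have [measurable]: "(\<lambda>u. G (snd (iterate u k)) (u k)) \<in> borel_measurable ?P"
      by simp
    show ?case
      unfolding iterate_Suc fst_conv snd_conv by (intro conjI) measurable
  qed
  then show "(\<lambda>u. fst (iterate u k)) \<in> borel_measurable ?P" "(\<lambda>u. snd (iterate u k)) \<in> borel_measurable ?P"
    "dual_next k \<in> borel_measurable ?P"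
    using dual by auto
qed

lemma borel_measurable_noise:
  assumes G_meas: "(\<lambda>(x, z). G x z) \<in> borel_measurable (borel \<Otimes>\<^sub>M N)"
  shows "(\<lambda>(u, z). noise k u z) \<in> borel_measurable (PiM {..<k} (\<lambda>_. N) \<Otimes>\<^sub>M N)"
proof -
  let ?P = "PiM {..<k} (\<lambda>_. N)"
  note [measurable] = borel_measurable_iterate[OF G_meas order_refl, of k]
  \<comment> \<open>\<open>gl\<close> is continuous only on \<open>X\<close>; composed with the
    projection it is continuous everywhere, and nothing changes at the iterates, which lie in
    \<open>X\<close>.\<close>
  have "continuous_on UNIV (\<lambda>x. gl (closest_point X x))"
    using closed nonempty X gl_cont closest_point_in_set
    by (intro continuous_on_compose2[OF gl_cont] continuous_on_closest_point) auto
  then have [measurable]: "(\<lambda>x. gl (closest_point X x)) \<in> borel_measurable borel"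
    by (rule borel_measurable_continuous_onI)
  have "(\<lambda>p. (snd (iterate (fst p) k), snd p)) \<in> measurable (?P \<Otimes>\<^sub>M N) (borel \<Otimes>\<^sub>M N)"
    by measurable
  from measurable_compose[OF this G_meas]
  have [measurable]: "(\<lambda>p. G (snd (iterate (fst p) k)) (snd p)) \<in> borel_measurable (?P \<Otimes>\<^sub>M N)"
    by simp
  have eq: "noise k u z = G (snd (iterate u k)) z - gl (closest_point X (snd (iterate u k)))" for u z
    by (simp add: noise_def closest_point_self iterate_in)
  show ?thesis
    unfolding eq split_beta by measurable
qed

lemma borel_measurable_predictable_point:
  assumes G_meas: "(\<lambda>(x, z). G x z) \<in> borel_measurable (borel \<Otimes>\<^sub>M N)"
  shows "predictable_point k \<in> borel_measurable (PiM {..<k} (\<lambda>_. N))"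
proof -
  note [measurable] = borel_measurable_iterate[OF G_meas order_refl, of k]
  have [measurable]: "closest_point X \<in> borel_measurable borel"
    using X closed nonempty by (auto intro!: borel_measurable_continuous_onI continuous_on_closest_point)
  have [measurable]: "(\<lambda>w. transpose F *v w) \<in> borel_measurable borel"
    by (intro borel_measurable_continuous_onI matrix_vector_mult_linear_continuous_on)+
  show ?thesis
    unfolding predictable_point_def by measurable
qed

end

section \<open>The probability bound\<close>

theorem theorem2:
  fixes X :: "(real^'d) set" and Y :: "(real^'l) set"
    and F :: "real^'d^'l"
    and l :: "real^'d \<Rightarrow> real" and gl :: "real^'d \<Rightarrow> real^'d"
    and G :: "real^'d \<Rightarrow> 's \<Rightarrow> real^'d"
    and L \<sigma> s \<Omega> :: real
    and M :: "'o measure" and N :: "'s measure" and Q :: "'s measure"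
    and \<xi> :: "nat \<Rightarrow> 'o \<Rightarrow> 's"
    and x0 xstar :: "real^'d" and y0 ystar :: "real^'l"
    and t :: nat
  assumes X: "convex X" "compact X" "X \<noteq> {}"
    and Y: "convex Y" "compact Y" "Y \<noteq> {}"
    and l_convex: "convex_on X l"
    and l_grad: "\<forall>x\<in>X. (l has_derivative (\<lambda>h. gl x \<bullet> h)) (at x within X)"
    and gl_cont: "continuous_on X gl"
    and L: "L \<ge> 0" "\<forall>x1\<in>X. \<forall>x2\<in>X. norm (gl x1 - gl x2) \<le> L * norm (x1 - x2)"
    and M: "prob_space M"
    and iid: "prob_space.indep_vars M (\<lambda>_. N) \<xi> UNIV" "\<forall>k. distr M N (\<xi> k) = Q"
    and G_meas: "(\<lambda>(x, z). G x z) \<in> borel_measurable (borel \<Otimes>\<^sub>M N)"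
    and sigma: "\<sigma> > 0"
    and unbiased: "\<forall>x\<in>X. integrable Q (G x) \<and> (\<integral>z. G x z \<partial>Q) = gl x"
    and var: "\<forall>x\<in>X. (\<integral>\<^sup>+ z. ennreal ((norm (G x z - gl x))\<^sup>2) \<partial>Q) \<le> ennreal (\<sigma>\<^sup>2)"
    and subgauss: "\<forall>x\<in>X. (\<integral>\<^sup>+ z. ennreal (exp ((norm (G x z - gl x))\<^sup>2 / \<sigma>\<^sup>2)) \<partial>Q) \<le> ennreal (exp 1)"
    and s: "s > 0"
    and init: "x0 \<in> X" "y0 \<in> Y"
    and saddle: "xstar \<in> X" "ystar \<in> Y"
      "\<forall>y\<in>Y. \<forall>x\<in>X. saddle_P l F y xstar \<le> saddle_P l F ystar xstar
                     \<and> saddle_P l F ystar xstar \<le> saddle_P l F ystar x"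
    and Omega: "\<Omega> > 0"
  shows
    "let beta = (\<lambda>k::nat. 1 / (sqrt (real k) + L));
         it = (\<lambda>\<omega> k. spdhg l G F X Y s beta x0 y0 (\<lambda>j. \<xi> j \<omega>) k);
         xbar = (\<lambda>\<omega>. \<Sum>k\<le>t. (1 / real (t + 1)) *\<^sub>R snd (it \<omega> (Suc k)));
         ybar = (\<lambda>\<omega>. \<Sum>k\<le>t. (1 / real (t + 1)) *\<^sub>R fst (it \<omega> (Suc k)));
         Dx = diameter X; Dy = diameter Y;
         bound = Dy\<^sup>2 / (2 * s * real (t + 1)) + L * Dx\<^sup>2 / (2 * real (t + 1))
               + (Dx\<^sup>2 + 2 * lambda_max (transpose F ** F) * Dy\<^sup>2) / sqrt (real (t + 1))
               + 2 * sqrt \<Omega> * Dx * \<sigma> / sqrt (real (t + 1))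
               + (1 + \<Omega>) * \<sigma>\<^sup>2 / sqrt (real (t + 1))
     in measure M {\<omega> \<in> space M. saddle_P l F ystar (xbar \<omega>) - saddle_P l F (ybar \<omega>) xstar > bound}
          \<le> 2 * exp (- \<Omega>)"
proof -
  interpret prob_space M by (rule M)
  interpret S: spdhg_setting X Y F l gl G L s x0 xstar y0 ystar
    using X Y l_convex l_grad gl_cont L s init saddle by unfold_locales auto
  have \<xi>[measurable]: "\<xi> k \<in> measurable M N" for k
    using iid(1) by (simp add: indep_vars_def)
  interpret Q: prob_space Q
    using prob_space_distr[OF \<xi>[of 0]] iid(2) by simp
  define D where "D = diameter X"
  define T where "T = real (t + 1)"
  define W where "W = (\<Sum>k<Suc t. 1 / sqrt (real (Suc k)))"
  define R where "R = 2 * sqrt \<Omega> * D * \<sigma> * sqrt T"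
  \<comment> \<open>The weight \<open>1 / sqrt (k + 1)\<close> is at most 1, as
    \<open>nn_integral_exp_mult_le\<close> requires; the division by \<open>\<sigma>^2\<close>
    matches the sub-Gaussian hypothesis.\<close>
  define h1 where "h1 = (\<lambda>k u z. 1 / sqrt (real (Suc k)) * ((norm (S.noise k u z))\<^sup>2 / \<sigma>\<^sup>2))"
  define h2 where "h2 = (\<lambda>k u z. S.noise k u z \<bullet> (xstar - S.predictable_point k u))"
  define sample_sum :: "(nat \<Rightarrow> (nat \<Rightarrow> 's) \<Rightarrow> 's \<Rightarrow> real) \<Rightarrow> 'o \<Rightarrow> real"
    where "sample_sum = (\<lambda>h \<omega>. \<Sum>k<Suc t. h k (restrict (\<lambda>j. \<xi> j \<omega>) {..<k}) (\<xi> k \<omega>))"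
  have T: "T \<ge> 1" by (simp add: T_def)
  have D: "norm (xstar - S.predictable_point k u) \<le> D" for k u
    using diameter_bounded_bound[OF compact_imp_bounded[OF X(2)] saddle(1) S.predictable_point_in]
    by (simp add: dist_norm D_def)
  have h_meas: "(\<lambda>(u, z). h1 k u z) \<in> borel_measurable (PiM {..<k} (\<lambda>_. N) \<Otimes>\<^sub>M N)"
    "(\<lambda>(u, z). h2 k u z) \<in> borel_measurable (PiM {..<k} (\<lambda>_. N) \<Otimes>\<^sub>M N)" for k
  proof -
    have [measurable]: "(\<lambda>p. S.noise k (fst p) (snd p)) \<in> borel_measurable (PiM {..<k} (\<lambda>_. N) \<Otimes>\<^sub>M N)"
      using S.borel_measurable_noise[OF G_meas, of k] by (simp add: split_beta)
    note [measurable] = S.borel_measurable_predictable_point[OF G_meas, of k]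
    show "(\<lambda>(u, z). h1 k u z) \<in> borel_measurable (PiM {..<k} (\<lambda>_. N) \<Otimes>\<^sub>M N)"
      "(\<lambda>(u, z). h2 k u z) \<in> borel_measurable (PiM {..<k} (\<lambda>_. N) \<Otimes>\<^sub>M N)"
      unfolding h1_def h2_def split_beta by measurable
  qed
  have sum_meas: "sample_sum h \<in> borel_measurable M"
    if h: "\<And>k. (\<lambda>(u, z). h k u z) \<in> borel_measurable (PiM {..<k} (\<lambda>_. N) \<Otimes>\<^sub>M N)" for h
    unfolding sample_sum_def
  proof (intro borel_measurable_sum)
    fix k
    have "(\<lambda>\<omega>. (restrict (\<lambda>j. \<xi> j \<omega>) {..<k}, \<xi> k \<omega>)) \<in> measurable M (PiM {..<k} (\<lambda>_. N) \<Otimes>\<^sub>M N)"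
      by measurable
    from measurable_compose[OF this h]
    show "(\<lambda>\<omega>. h k (restrict (\<lambda>j. \<xi> j \<omega>) {..<k}) (\<xi> k \<omega>)) \<in> borel_measurable M"
      by simp
  qed
  note S_meas = sum_meas[of h1, OF h_meas(1)] sum_meas[of h2, OF h_meas(2)]
  have noise_Q[measurable]: "S.noise k u \<in> borel_measurable Q" for k u
    unfolding S.noise_def[abs_def] using unbiased S.iterate_in(1)[of u k] by auto
  have noise_sg: "(\<integral>\<^sup>+ z. ennreal (exp ((norm (S.noise k u z))\<^sup>2 / \<sigma>\<^sup>2)) \<partial>Q) \<le> ennreal (exp 1)" for k u
    unfolding S.noise_def using subgauss S.iterate_in(1) by blast

  have "(\<integral>\<^sup>+ \<omega>. ennreal (exp (sample_sum h1 \<omega>)) \<partial>M) \<le> ennreal (exp W)"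
    unfolding sample_sum_def W_def
  proof (rule nn_integral_exp_sum_indep_le[OF iid(1) _ h_meas(1)])
    fix k and u :: "nat \<Rightarrow> 's"
    show "(\<integral>\<^sup>+ z. ennreal (exp (h1 k u z)) \<partial>Q) \<le> ennreal (exp (1 / sqrt (real (Suc k))))"
      unfolding h1_def using noise_sg by (intro Q.nn_integral_exp_mult_le) auto
  qed (use iid in blast)
  \<comment> \<open>Chernoff with parameter 1: the deviation \<open>\<Omega>\<close> beyond the
    exponent budget \<open>W\<close> costs exactly \<open>exp (- \<Omega>)\<close>.\<close>
  then have "prob {\<omega> \<in> space M. sample_sum h1 \<omega> > W + \<Omega>} \<le> exp (W - 1 * (W + \<Omega>))"
    by (intro prob_gt_le_exp S_meas) auto
  then have P1: "prob {\<omega> \<in> space M. sample_sum h1 \<omega> > W + \<Omega>} \<le> exp (- \<Omega>)"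
    by simp

  have P2: "prob {\<omega> \<in> space M. sample_sum h2 \<omega> > R} \<le> exp (- \<Omega>)"
  proof (cases "D = 0")
    \<comment> \<open>\<open>X\<close> is a single point, so the increments vanish; this case is
      separated because \<open>\<theta>\<close> below divides by \<open>D\<close>.\<close>
    case True
    then have "h2 k u z = 0" for k u z
      using D[of k u] by (simp add: h2_def)
    with True have "{\<omega> \<in> space M. sample_sum h2 \<omega> > R} = {}"
      by (simp add: sample_sum_def R_def)
    then show ?thesis
      by (simp only: measure_empty exp_ge_zero)
  next
    case False
    with order_trans[OF norm_ge_zero D] have "D > 0"
      by (simp add: less_le)
    define v where "v = D * \<sigma>"
    have v: "v > 0" using \<open>D > 0\<close> sigma by (simp add: v_def)
    \<comment> \<open>The minimiser of the Chernoff exponent T \<theta>^2 v^2 - \<theta> R. At this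
      value the first term is \<open>\<Omega>\<close> and the second is
      \<open>2 * \<Omega>\<close>.\<close>
    define \<theta> where "\<theta> = sqrt \<Omega> / (sqrt T * v)"
    have \<theta>: "\<theta> > 0" using v T Omega by (simp add: \<theta>_def)
    have "(\<integral>\<^sup>+ \<omega>. ennreal (exp (sample_sum (\<lambda>k u z. \<theta> * h2 k u z) \<omega>)) \<partial>M) \<le> ennreal (exp (\<Sum>k<Suc t. \<theta>\<^sup>2 * v\<^sup>2))"
      unfolding sample_sum_def
    proof (rule nn_integral_exp_sum_indep_le[OF iid(1)])
      fix k
      show "(\<lambda>(u, z). \<theta> * h2 k u z) \<in> borel_measurable (PiM {..<k} (\<lambda>_. N) \<Otimes>\<^sub>M N)"
        using h_meas(2)[of k] by (simp add: split_beta)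
    next
      fix k and u :: "nat \<Rightarrow> 's"
      have int: "integrable Q (S.noise k u)" "(\<integral>z. S.noise k u z \<partial>Q) = 0"
        using unbiased S.iterate_in(1)[of u k] by (auto simp: S.noise_def[abs_def] Q.prob_space)
      show "(\<integral>\<^sup>+ z. ennreal (exp (\<theta> * h2 k u z)) \<partial>Q) \<le> ennreal (exp (\<theta>\<^sup>2 * v\<^sup>2))"
      \<comment> \<open>With the past \<open>u\<close> fixed, \<open>predictable_point k u\<close>
        is a constant vector, so \<open>h2\<close> inherits mean zero from the noise, and
        Cauchy-Schwarz makes it sub-Gaussian with parameter \<open>v = D * \<sigma>\<close>.\<close>
      proof (rule Q.sub_gaussian_mgf[OF _ _ v])
        show "integrable Q (h2 k u)" "Q.expectation (h2 k u) = 0"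
          unfolding h2_def using int by auto
        have "(\<integral>\<^sup>+ z. ennreal (exp ((h2 k u z)\<^sup>2 / v\<^sup>2)) \<partial>Q) \<le> (\<integral>\<^sup>+ z. ennreal (exp ((norm (S.noise k u z))\<^sup>2 / \<sigma>\<^sup>2)) \<partial>Q)"
        proof (intro nn_integral_mono ennreal_leI)
          fix z
          have "\<bar>h2 k u z\<bar> \<le> norm (S.noise k u z) * norm (xstar - S.predictable_point k u)"
            unfolding h2_def by (rule Cauchy_Schwarz_ineq2)
          also have "\<dots> \<le> norm (S.noise k u z) * D"
            by (intro mult_left_mono D) auto
          finally have "(h2 k u z)\<^sup>2 \<le> (norm (S.noise k u z) * D)\<^sup>2"
            using power_mono[of "\<bar>h2 k u z\<bar>" _ 2] by fastforce
          then show "exp ((h2 k u z)\<^sup>2 / v\<^sup>2) \<le> exp ((norm (S.noise k u z))\<^sup>2 / \<sigma>\<^sup>2)"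
            using \<open>D > 0\<close> sigma by (simp add: v_def power_mult_distrib field_simps)
        qed
        also have "\<dots> \<le> ennreal (exp 1)"
          by (rule noise_sg)
        finally show "(\<integral>\<^sup>+ z. ennreal (exp ((h2 k u z)\<^sup>2 / v\<^sup>2)) \<partial>Q) \<le> ennreal (exp 1)" .
      qed
    qed (use iid in blast)
    moreover have "sample_sum (\<lambda>k u z. \<theta> * h2 k u z) \<omega> = \<theta> * sample_sum h2 \<omega>" for \<omega>
      by (simp add: sample_sum_def sum_distrib_left distrib_left)
    moreover have "(\<Sum>k<Suc t. \<theta>\<^sup>2 * v\<^sup>2) = \<Omega>"
    proof -
      have "(\<Sum>k<Suc t. \<theta>\<^sup>2 * v\<^sup>2) = T * (\<theta>\<^sup>2 * v\<^sup>2)"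
        by (simp add: T_def algebra_simps)
      then show ?thesis
        using v T Omega by (simp add: \<theta>_def power_divide power_mult_distrib)
    qed
    ultimately have "prob {\<omega> \<in> space M. sample_sum h2 \<omega> > R} \<le> exp (\<Omega> - \<theta> * R)"
      using \<theta> by (intro prob_gt_le_exp S_meas) auto
    moreover have "\<theta> * R = 2 * \<Omega>"
      using \<open>D > 0\<close> sigma T Omega by (simp add: \<theta>_def R_def v_def field_simps)
    ultimately show ?thesis by simp
  qed

  have beta: "(\<lambda>k. 1 / (sqrt (real k) + L)) = S.step_size"
    by (simp add: fun_eq_iff S.step_size_def)
  define bound where "bound = (diameter Y)\<^sup>2 / (2 * s * T) + L * D\<^sup>2 / (2 * T)
               + (D\<^sup>2 + 2 * lambda_max (transpose F ** F) * (diameter Y)\<^sup>2) / sqrt T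
               + 2 * sqrt \<Omega> * D * \<sigma> / sqrt T + (1 + \<Omega>) * \<sigma>\<^sup>2 / sqrt T"
  define gap where "gap = (\<lambda>\<omega>. saddle_P l F ystar (\<Sum>k\<le>t. (1 / T) *\<^sub>R snd (S.iterate (\<lambda>j. \<xi> j \<omega>) (Suc k)))
      - saddle_P l F (\<Sum>k\<le>t. (1 / T) *\<^sub>R fst (S.iterate (\<lambda>j. \<xi> j \<omega>) (Suc k))) xstar)"
  \<comment> \<open>Outside the two bad events the gap bound is deterministic; its negation gives
    the inclusion for the union bound.\<close>
  have gap_le: "gap \<omega> \<le> bound" if S1: "sample_sum h1 \<omega> \<le> W + \<Omega>" and S2: "sample_sum h2 \<omega> \<le> R" for \<omega>
  proof -
    let ?u = "\<lambda>j. \<xi> j \<omega>" and ?A = "lambda_max (transpose F ** F) * (diameter Y)\<^sup>2"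
    define q where "q = sqrt T"
    have q: "q \<ge> 1" "T = q\<^sup>2" "q > 0" using T by (auto simp: q_def)
    have "(\<Sum>k\<le>t. (norm (S.noise k ?u (\<xi> k \<omega>)))\<^sup>2 / (2 * sqrt (real (Suc k)))) = \<sigma>\<^sup>2 / 2 * sample_sum h1 \<omega>"
      unfolding sample_sum_def h1_def S.noise_restrict sum_distrib_left lessThan_Suc_atMost
      using sigma by (intro sum.cong) (auto simp: field_simps)
    moreover have "(\<Sum>k\<le>t. S.noise k ?u (\<xi> k \<omega>) \<bullet> (xstar - S.predictable_point k ?u)) = sample_sum h2 \<omega>"
      unfolding sample_sum_def h2_def S.noise_restrict S.predictable_point_restrict lessThan_Suc_atMost ..
    ultimately have "gap \<omega> \<le> 1 / T * ((q + L) / 2 * D\<^sup>2 + (diameter Y)\<^sup>2 / (2 * s) + ?A * q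
        + \<sigma>\<^sup>2 / 2 * sample_sum h1 \<omega> + sample_sum h2 \<omega>)"
      using S.saddle_gap_average_le[of t ?u] by (simp only: gap_def T_def D_def q_def)
    also have "\<dots> \<le> 1 / T * ((q + L) / 2 * D\<^sup>2 + (diameter Y)\<^sup>2 / (2 * s) + ?A * q
        + \<sigma>\<^sup>2 / 2 * (2 * q + \<Omega>) + R)"
    proof (intro mult_left_mono add_mono order_refl S2)
      have "W \<le> 2 * q"
        using sum_inverse_sqrt_le[of t] unfolding W_def q_def T_def lessThan_Suc_atMost by simp
      with S1 show "sample_sum h1 \<omega> \<le> 2 * q + \<Omega>" by simp
    qed (use T q L lambda_max_nonneg[of F] in auto)
    also have "\<dots> \<le> 1 / T * (q * D\<^sup>2 + L / 2 * D\<^sup>2 + (diameter Y)\<^sup>2 / (2 * s) + 2 * ?A * q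
        + (1 + \<Omega>) * \<sigma>\<^sup>2 * q + R)"
    proof -
      have "0 \<le> q * D\<^sup>2" "0 \<le> ?A * q"
        using q by (simp_all add: lambda_max_nonneg)
      \<comment> \<open>The noise squares contribute
        \<open>\<sigma>^2 q + \<Omega> \<sigma>^2 / 2\<close>; as \<open>q \<ge> 1\<close>, the
        second summand fits into the stated \<open>\<Omega> \<sigma>^2 q\<close>.\<close>
      moreover have "\<Omega> * \<sigma>\<^sup>2 * 1 \<le> \<Omega> * \<sigma>\<^sup>2 * (2 * q)"
        using q Omega by (intro mult_left_mono) auto
      ultimately show ?thesis
        using T by (intro mult_left_mono) (auto simp: algebra_simps add_divide_distrib)
    qed
    \<comment> \<open>Since \<open>T = q^2\<close>, dividing by \<open>T\<close> turns each factor
      \<open>q\<close> into \<open>1 / sqrt T\<close>, including the one inside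
      \<open>R\<close>.\<close>
    also have "\<dots> = bound"
      unfolding bound_def R_def q_def[symmetric] q(2) using q s by (simp add: field_simps power2_eq_square)
    finally show ?thesis .
  qed
  have "{\<omega> \<in> space M. gap \<omega> > bound} \<subseteq>
      {\<omega> \<in> space M. sample_sum h1 \<omega> > W + \<Omega>} \<union> {\<omega> \<in> space M. sample_sum h2 \<omega> > R}"
    using gap_le by (force simp: not_le)
  then have "prob {\<omega> \<in> space M. gap \<omega> > bound} \<le>
      prob ({\<omega> \<in> space M. sample_sum h1 \<omega> > W + \<Omega>} \<union> {\<omega> \<in> space M. sample_sum h2 \<omega> > R})"
    using S_meas by (intro finite_measure_mono) auto
  also have "\<dots> \<le> prob {\<omega> \<in> space M. sample_sum h1 \<omega> > W + \<Omega>} + prob {\<omega> \<in> space M. sample_sum h2 \<omega> > R}"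
    using S_meas by (intro measure_Un_le) auto
  also have "\<dots> \<le> 2 * exp (- \<Omega>)"
    using P1 P2 by simp
  finally show ?thesis
    unfolding Let_def beta gap_def bound_def D_def T_def S.iterate_def .
qed

end
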